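(* If $R$ is a graph on $s$ vertices, then \[ \phi(R)\le\phi(K_s)=s(2^{s-1}-1). \]
   Context: Graphs are finite and simple. For a graph $R$ and nonempty $I\subseteq V(R)$, $\delta_I=\min\{d_R(x):x\in I\}$, and the fixed loss of $R$ is \[ \phi(R)=\sum_{\substack{I \text{ independent in } R\\ I\neq\emptyset}}\bigl(2^{\delta_I}-1\bigr). \] $K_s$ is the complete graph on $s$ vertices. *)

theory Defs
  imports "Graph_Theory.Kuratowski"
begin

text \<open>
  A finite simple graph is a \<^locale>\<open>graph\<close>: a finite, loop-free, symmetric digraph without
  parallel arcs, each edge \<open>uv\<close> being represented by the two arcs \<open>u \<rightarrow> v\<close> and \<open>v \<rightarrow> u\<close>.
  The degree of a vertex is therefore its out-degree, i.e. its number of neighbours.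
\<close>

lemma (in graph) out_degree_eq_card_neighbours:
  "out_degree G v = card {w. v \<rightarrow>\<^bsub>G\<^esub> w}"
proof -
  have "inj_on (head G) (out_arcs G v)"
    by (auto intro!: inj_onI no_multi_arcs simp: arc_to_ends_def)
  moreover have "head G ` out_arcs G v = {w. v \<rightarrow>\<^bsub>G\<^esub> w}"
    by (auto simp: arcs_ends_def arc_to_ends_def)
  ultimately show ?thesis
    unfolding out_degree_def by (metis card_image)
qed

text \<open>
  The complete graph \<open>K\<^sub>s\<close> is given by the predicate \<^const>\<open>complete_digraph\<close>, which is
  satisfiable for every \<open>s\<close>.
\<close>

lemma complete_digraph_exists: "\<exists>K :: (nat, nat \<times> nat) pre_digraph. K\<^bsub>s\<^esub> K"
proof
  show "K\<^bsub>s\<^esub> (with_proj \<lparr>pverts = {..<s}, parcs = {(u, v). u < s \<and> v < s \<and> u \<noteq> v}\<rparr>)"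
    by (auto simp: complete_digraph_pair_def)
qed

definition independent_set :: "('a, 'b) pre_digraph \<Rightarrow> 'a set \<Rightarrow> bool" where
  "independent_set R I \<longleftrightarrow> I \<subseteq> verts R \<and> (\<forall>u\<in>I. \<forall>v\<in>I. \<not> u \<rightarrow>\<^bsub>R\<^esub> v)"

definition min_degree_on :: "('a, 'b) pre_digraph \<Rightarrow> 'a set \<Rightarrow> nat" where
  "min_degree_on R I = Min (out_degree R ` I)"

definition fixed_loss :: "('a, 'b) pre_digraph \<Rightarrow> int" where
  "fixed_loss R = (\<Sum>I | independent_set R I \<and> I \<noteq> {}. 2 ^ min_degree_on R I - 1)"

end

theory Submission
  imports Defs
begin

text \<open>
  Assign to each nonempty independent set one of its vertices \<open>x\<close> of minimum degree \<open>d\<close>.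
  The rest of the set lies among the \<open>s - 1 - d\<close> non-neighbours of \<open>x\<close>, so at most
  \<open>2\<^bsup>s-1-d\<^esup>\<close> sets are assigned to \<open>x\<close>, contributing at most
  \<open>2\<^bsup>s-1-d\<^esup> (2\<^bsup>d\<^esup> - 1) \<le> 2\<^bsup>s-1\<^esup> - 1\<close> in total.
\<close>

text \<open>The predicate \<open>P\<close> stays free so that one fact serves both the count of sets
  through a vertex and the sum over nonempty sets.\<close>

lemma (in graph) finite_independent_sets: "finite {I. independent_set G I \<and> P I}"
  by (rule finite_subset[of _ "Pow (verts G)"]) (auto simp: independent_set_def)

lemma (in graph) neighbours_subset: "{w. v \<rightarrow>\<^bsub>G\<^esub> w} \<subseteq> verts G - {v}"
  using adj_not_same by (auto simp: adj_in_verts)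

lemma (in graph) out_degree_le:
  assumes "v \<in> verts G"
  shows "out_degree G v \<le> card (verts G) - 1"
proof -
  have "card {w. v \<rightarrow>\<^bsub>G\<^esub> w} \<le> card (verts G - {v})"
    using neighbours_subset by (intro card_mono) auto
  then show ?thesis
    using assms by (simp add: out_degree_eq_card_neighbours)
qed

lemma (in graph) card_independent_sets_containing:
  assumes "v \<in> verts G"
  shows "card {I. independent_set G I \<and> v \<in> I} \<le> 2 ^ (card (verts G) - 1 - out_degree G v)"
proof -
  let ?A = "{I. independent_set G I \<and> v \<in> I}"
  let ?W = "verts G - {v} - {w. v \<rightarrow>\<^bsub>G\<^esub> w}"
  have "card ?A \<le> card (Pow ?W)"
  proof (rule card_inj_on_le)
    \<comment> \<open>Every set counted contains \<open>v\<close>, so deleting \<open>v\<close>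
      loses no information.\<close>
    show "inj_on (\<lambda>I. I - {v}) ?A"
      by (auto simp: inj_on_def)
    show "(\<lambda>I. I - {v}) ` ?A \<subseteq> Pow ?W"
      by (auto simp: independent_set_def)
  qed simp
  also have "\<dots> = 2 ^ card ?W"
    by (simp add: card_Pow)
  \<comment> \<open>As \<open>v\<close> is not its own neighbour, the two removals are disjoint and
    both lie in \<open>verts G\<close>, so the cardinalities subtract exactly.\<close>
  also have "card ?W = card (verts G) - 1 - out_degree G v"
    using assms neighbours_subset[of v] finite_subset[OF neighbours_subset[of v]]
    by (simp add: card_Diff_subset out_degree_eq_card_neighbours)
  finally show ?thesis .
qed

lemma (in graph) fixed_loss_le:
  "fixed_loss G \<le> int (card (verts G)) * (2 ^ (card (verts G) - 1) - 1)"
proof -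
  let ?S = "{I. independent_set G I \<and> I \<noteq> {}}"
  let ?n = "card (verts G) - 1"
  \<comment> \<open>Ties between vertices of minimum degree are broken by an arbitrary choice; all
    that matters is that each set is assigned to exactly one vertex.\<close>
  define m where "m I = (SOME x. x \<in> I \<and> min_degree_on G I = out_degree G x)" for I
  have m: "m I \<in> I \<and> min_degree_on G I = out_degree G (m I)" if "I \<in> ?S" for I
  proof -
    have "finite I"
      using that finite_subset[OF _ finite_verts] by (auto simp: independent_set_def)
    then have "min_degree_on G I \<in> out_degree G ` I"
      using that unfolding min_degree_on_def by (intro Min_in) auto
    then have "\<exists>x. x \<in> I \<and> min_degree_on G I = out_degree G x"
      by blast
    then show ?thesis
      unfolding m_def by (rule someI_ex)
  qed
  have mV: "m ` ?S \<subseteq> verts G"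
  proof (rule image_subsetI)
    fix I assume I: "I \<in> ?S"
    then have "I \<subseteq> verts G"
      by (simp add: independent_set_def)
    with m[OF I] show "m I \<in> verts G"
      by blast
  qed
  have loss_at: "(\<Sum>I | I \<in> ?S \<and> m I = v. 2 ^ min_degree_on G I - 1) \<le> (2 ^ ?n - 1 :: int)"
    if v: "v \<in> verts G" for v
  proof -
    let ?d = "out_degree G v"
    have "(\<Sum>I | I \<in> ?S \<and> m I = v. 2 ^ min_degree_on G I - 1)
        = (\<Sum>I | I \<in> ?S \<and> m I = v. 2 ^ ?d - 1 :: int)"
      by (rule sum.cong) (simp_all add: m)
    also have "\<dots> = int (card {I. I \<in> ?S \<and> m I = v}) * (2 ^ ?d - 1)"
      by simp
    also have "\<dots> \<le> 2 ^ (?n - ?d) * (2 ^ ?d - 1)"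
    proof (rule mult_right_mono)
      \<comment> \<open>Since \<open>m I\<close> belongs to \<open>I\<close>, the fibre of
        \<open>m\<close> over \<open>v\<close> consists of independent sets through
        \<open>v\<close>.\<close>
      have "card {I. I \<in> ?S \<and> m I = v} \<le> card {I. independent_set G I \<and> v \<in> I}"
        by (intro card_mono finite_independent_sets) (use m in blast)
      also have "\<dots> \<le> 2 ^ (?n - ?d)"
        using v by (rule card_independent_sets_containing)
      finally show "int (card {I. I \<in> ?S \<and> m I = v}) \<le> 2 ^ (?n - ?d)"
        by simp
    qed simp
    \<comment> \<open>The subtraction in the exponent truncates, so merging the powers into
      \<open>2 ^ ?n\<close> requires the degree bound \<open>out_degree_le\<close>.\<close>
    also have "\<dots> = 2 ^ ?n - 2 ^ (?n - ?d)"
      using out_degree_le[OF v] by (simp add: right_diff_distrib flip: power_add)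
    also have "\<dots> \<le> 2 ^ ?n - 1"
      by simp
    finally show ?thesis .
  qed
  \<comment> \<open>The sum is split along the fibres of \<open>m\<close>; a vertex that is never
    chosen contributes an empty sum.\<close>
  have "fixed_loss G = (\<Sum>v\<in>verts G. \<Sum>I | I \<in> ?S \<and> m I = v. 2 ^ min_degree_on G I - 1)"
    unfolding fixed_loss_def
    by (rule sum.group[symmetric, OF finite_independent_sets _ mV]) simp
  also have "\<dots> \<le> (\<Sum>v\<in>verts G. 2 ^ ?n - 1)"
    by (intro sum_mono loss_at)
  finally show ?thesis
    by simp
qed

text \<open>Distinct vertices are adjacent, so the nonempty independent sets are the singletons, one
  per vertex, each of minimum degree \<open>s - 1\<close>. For \<open>s = 0\<close> the truncated
  exponent is harmless, as both sides vanish.\<close>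

lemma fixed_loss_complete:
  assumes "K\<^bsub>s\<^esub> K"
  shows "fixed_loss K = int s * (2 ^ (s - 1) - 1)"
proof -
  interpret graph K
    using assms by (simp add: complete_digraph_def)
  have card: "card (verts K) = s"
    and arcs: "arcs_ends K = {(u, v). (u, v) \<in> verts K \<times> verts K \<and> u \<noteq> v}"
    using assms by (auto simp: complete_digraph_def)
  have sets: "{I. independent_set K I \<and> I \<noteq> {}} = (\<lambda>v. {v}) ` verts K"
  proof (intro equalityI subsetI)
    fix I assume "I \<in> {I. independent_set K I \<and> I \<noteq> {}}"
    then obtain v where "I \<subseteq> verts K" "v \<in> I" "\<forall>u\<in>I. \<forall>w\<in>I. u = w"
      by (fastforce simp: independent_set_def arcs)
    then have "I = {v}" "v \<in> verts K"
      by blast+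
    then show "I \<in> (\<lambda>v. {v}) ` verts K"
      by simp
  qed (auto simp: independent_set_def arcs)
  have degree: "out_degree K v = s - 1" if "v \<in> verts K" for v
  proof -
    have "{w. v \<rightarrow>\<^bsub>K\<^esub> w} = verts K - {v}"
      using that by (auto simp: arcs)
    then show ?thesis
      using that card by (simp add: out_degree_eq_card_neighbours)
  qed
  have "fixed_loss K = (\<Sum>v\<in>verts K. 2 ^ min_degree_on K {v} - 1)"
    unfolding fixed_loss_def sets by (simp add: sum.reindex inj_on_def)
  also have "\<dots> = (\<Sum>v\<in>verts K. 2 ^ (s - 1) - 1)"
    by (intro sum.cong) (auto simp: min_degree_on_def degree)
  finally show ?thesis
    by (simp add: card)
qed

theorem theorem4p6:
  fixes R :: "('a, 'b) pre_digraph" and K :: "('c, 'd) pre_digraph" and s :: nat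
  assumes "graph R" and "card (verts R) = s" and "K\<^bsub>s\<^esub> K"
  shows "fixed_loss R \<le> fixed_loss K \<and> fixed_loss K = int s * (2 ^ (s - 1) - 1)"
  using graph.fixed_loss_le[OF assms(1)] fixed_loss_complete[OF assms(3)] assms(2) by simp

end
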